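(* Let $S(X)$ be a schematic extended Herbrand sequent $F[\bar x\backslash U_1],\bigvee_{i=1}^pX(\alpha,t_i)\to\bigwedge_{j=1}^mX(r_j,\beta_j)\vdash G[\bar y\backslash U_2]$, let $\psi$ be a maximal $\mathbf{G3c}$-derivation of its reduced representation, let $\mathcal A$ be a starting set with $\mathrm{Sol}(\mathcal A)\neq\emptyset$ (defined with respect to $\psi$), and let $\mathcal C\in\mathrm{Sol}(\mathcal A)$. Let $E=\mathrm{DNF}(\mathcal C)$ and $\hat E=\lambda xy.E$. Then $$F[\bar x\backslash U_1],\ \bigvee_{i=1}^p\hat E\alpha t_i\to\bigwedge_{j=1}^m\hat E r_j\beta_j\ \vdash\ G[\bar y\backslash U_2]$$ is a tautology.
   Context: Sequents are pairs of sets of formulas; $\mathbf{G3c}$ is the invertible cut-free sequent calculus for classical first-order logic. A $\mathbf{G3c}$-derivation of a sequent is a tree of sequents rooted at it in which each node is the conclusion of a $\mathbf{G3c}$ rule with its children as premises; it is maximal if no leaf is the conclusion of a rule (for quantifier-free sequents the leaves consist of atoms; a leaf is tautological iff some atom occurs on both sides). Setting: $F,G$ quantifier-free formulas, $\bar x=(x_1,\dots,x_k)$, $\bar y=(y_1,\dots,y_l)$, $\forall\bar xF\vdash\exists\bar yG$ provable, $h_F,h_G$ fresh function symbols of arities $k,l$. A Herbrand term set of this sequent is $\{h_F(\bar t_1),\dots,h_F(\bar t_{k'}),h_G(\bar t_{k'+1}),\dots,h_G(\bar t_n)\}$ where $F[\bar x\backslash\bar t_1],\dots,F[\bar x\backslash\bar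 t_{k'}]\vdash G[\bar y\backslash\bar t_{k'+1}],\dots,G[\bar y\backslash\bar t_n]$ is valid. A schematic $\Pi_2$-grammar has nonterminals $\tau,\alpha,\beta_1,\dots,\beta_m$ (ordered $\beta_1<\dots<\beta_m<\alpha<\tau$) and productions $\tau\to h_F(\bar u_1)\mid\dots\mid h_F(\bar u_N)\mid h_G(\bar v_1)\mid\dots\mid h_G(\bar v_M)$ with variables of $\bar u_i$ among $\{\alpha\}$ and of $\bar v_j$ among $\{\beta_1,\dots,\beta_m\}$; $\alpha\to r_1\mid\dots\mid r_m$ with $r_1$ variable-free and variables of $r_j$ among $\{\beta_1,\dots,\beta_{j-1}\}$; $\beta_j\to t_1[\alpha\backslash r_j]\mid\dots\mid t_p[\alpha\backslash r_j]$ for terms $t_1,\dots,t_p$ with variables among $\{\alpha\}$. Its language consists of the ground terms derivable from $\tau$ by rigid derivations (each nonterminal is rewritten by one and the same production throughout the derivation). If a Herbrand term set is contained in this language, $U_1=\{\bar u_1,\dots,\bar u_N\}$, $U_2=\{\bar v_1,\dots,\bar v_M\}$ and $X$ is a binary predicate variable, then $S(X):F[\bar x\backslash U_1],\bigvee_{i=1}^pX(\alpha,t_i)\to\bigwedge_{j=1}^mX(r_j,\beta_j)\vdash G[\bar y\backslash U_2]$ is a schematic extended Herbrand sequent (here $F[\bar x\backslash U]$ is the list of instances), and $R: F[\bar x\backslash U_1]\vdash G[\bar y\backslash U_2]$ is its reduced representation. For a formula $E$ in designated variables $x,y$, $\hat E=\lambda xy.E$, so $\hat E st=E[x\backslash s,y\backslash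 t]$. Leaves: for a sequent of atoms $P_1,\dots,P_i\vdash Q_1,\dots,Q_j$ put $D(\cdot)=\neg Q_1,\dots,\neg Q_j,P_1,\dots,P_i\vdash$; $\mathrm{DNTA}(\psi)=\{D(S'):S'$ a non-tautological leaf of $\psi\}$, each viewed as a set of literals. For $S\in\mathrm{DNTA}(\psi)$: $A(S)$ = literals containing $\alpha$; $B(S)$ = literals containing some $\beta_j$; $N(S)$ = literals containing neither $\alpha$ nor any $\beta_j$. $\overline L$ is the complementary literal and $\overline{M}=\{\overline L:L\in M\}$. A starting set is a finite set of finite sets of literals (clauses) with variables among $\{x,y\}$ not containing $\alpha,\beta_1,\dots,\beta_m$. For a finite set of clauses $\mathcal C$, $\mathrm{DNF}(\mathcal C)=\bigvee_{C\in\mathcal C}\bigwedge_{L\in C}L$. $\mathrm{Cl}(\mathcal A)$ is the set of $\mathcal C\subseteq\mathcal A$ such that for every $(C_1,\dots,C_m)\in\mathcal C^m$ and every $S\in\mathrm{DNTA}(\psi)$ at least one holds: ($T_1$) $\exists i\,\exists L\in C_i$: $L[x\backslash r_i]\in\overline{N(S)}$; ($T_2$) $\exists i\,\exists L\in C_i$: $L[x\backslash r_i,y\backslash\beta_i]\in\overline{B(S)}$; ($T_3$) $\exists i,j\,\exists L\in C_i\,\exists Q\in C_j$: $L[x\backslash r_i,y\backslash\beta_i]=\overline Q[x\backslash r_j,y\backslash\beta_j]$. $A'(S)$ = set of literals $L$ with variables among $\{x,y\}$ such that $L[x\backslash\alpha,y\backslash t_i]\in A(S)$ for some $i$; $I(S)$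 = set of subsets $M\subseteq A'(S)$ such that for some $i\in\{1,\dots,p\}$, $L[x\backslash\alpha,y\backslash t_i]\in A(S)$ for all $L\in M$. $\mathrm{Sol}(\mathcal A)$ is the set of $\mathcal C\in\mathrm{Cl}(\mathcal A)$ such that for every choice of literals $L_{C,i}\in C$ ($C\in\mathcal C$, $i\in\{1,\dots,p\}$) and every $S\in\mathrm{DNTA}(\psi)$ at least one holds: ($T'_1$) $\exists C\in\mathcal C\,\exists i$: $L_{C,i}[y\backslash t_i]\in N(S)$; ($T'_2$) $\exists C\in\mathcal C\,\exists I\in I(S)\,\forall i$: $L_{C,i}\in I$; ($T'_3$) $\exists C,D\in\mathcal C\,\exists i,j$: $L_{C,i}[x\backslash\alpha,y\backslash t_i]=\overline{L_{D,j}}[x\backslash\alpha,y\backslash t_j]$. *)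

theory Defs
  imports Main
begin

section \<open>First-order syntax\<close>

type_synonym var = nat

datatype (tfuns: 'f, tvars: 'v) tm = Var 'v | Fun 'f "('f, 'v) tm list"

type_synonym 'f trm = "('f, var) tm"

text \<open>Falsum is a constant of the language because the empty disjunction has to be a formula.\<close>

datatype ('p, ffuns: 'f) fm =
    Atom 'p "'f trm list"
  | Bot
  | Neg "('p, 'f) fm"
  | And "('p, 'f) fm" "('p, 'f) fm"
  | Or "('p, 'f) fm" "('p, 'f) fm"
  | Imp "('p, 'f) fm" "('p, 'f) fm"
  | Forall var "('p, 'f) fm"
  | Exists var "('p, 'f) fm"

primrec fv :: "('p, 'f) fm \<Rightarrow> var set" where
  "fv (Atom P ts) = (\<Union>t\<in>set ts. tvars t)"
| "fv Bot = {}"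
| "fv (Neg A) = fv A"
| "fv (And A B) = fv A \<union> fv B"
| "fv (Or A B) = fv A \<union> fv B"
| "fv (Imp A B) = fv A \<union> fv B"
| "fv (Forall x A) = fv A - {x}"
| "fv (Exists x A) = fv A - {x}"

primrec quantifier_free :: "('p, 'f) fm \<Rightarrow> bool" where
  "quantifier_free (Atom P ts) = True"
| "quantifier_free Bot = True"
| "quantifier_free (Neg A) = quantifier_free A"
| "quantifier_free (And A B) = (quantifier_free A \<and> quantifier_free B)"
| "quantifier_free (Or A B) = (quantifier_free A \<and> quantifier_free B)"
| "quantifier_free (Imp A B) = (quantifier_free A \<and> quantifier_free B)"
| "quantifier_free (Forall x A) = False"
| "quantifier_free (Exists x A) = False"

primrec is_atom :: "('p, 'f) fm \<Rightarrow> bool" where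
  "is_atom (Atom P ts) = True"
| "is_atom Bot = False"
| "is_atom (Neg A) = False"
| "is_atom (And A B) = False"
| "is_atom (Or A B) = False"
| "is_atom (Imp A B) = False"
| "is_atom (Forall x A) = False"
| "is_atom (Exists x A) = False"

definition is_literal :: "('p, 'f) fm \<Rightarrow> bool" where
  "is_literal L \<longleftrightarrow> is_atom L \<or> (\<exists>A. is_atom A \<and> L = Neg A)"

text \<open>The complementary literal; only meaningful on literals.\<close>

definition compl :: "('p, 'f) fm \<Rightarrow> ('p, 'f) fm" where
  "compl L = (case L of Neg A \<Rightarrow> A | _ \<Rightarrow> Neg L)"

primrec tsubst :: "'f trm \<Rightarrow> (var \<Rightarrow> 'f trm) \<Rightarrow> 'f trm" where
  "tsubst (Var v) \<sigma> = \<sigma> v"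
| "tsubst (Fun f ts) \<sigma> = Fun f (map (\<lambda>t. tsubst t \<sigma>) ts)"

definition avoid :: "var \<Rightarrow> var set \<Rightarrow> var" where
  "avoid x V = (if x \<in> V then LEAST z. z \<notin> V else x)"

text \<open>Simultaneous capture-avoiding substitution: a bound variable is renamed exactly when it
  would capture a variable of a substituted term.\<close>

primrec fsubst :: "('p, 'f) fm \<Rightarrow> (var \<Rightarrow> 'f trm) \<Rightarrow> ('p, 'f) fm" where
  "fsubst (Atom P ts) \<sigma> = Atom P (map (\<lambda>t. tsubst t \<sigma>) ts)"
| "fsubst Bot \<sigma> = Bot"
| "fsubst (Neg A) \<sigma> = Neg (fsubst A \<sigma>)"
| "fsubst (And A B) \<sigma> = And (fsubst A \<sigma>) (fsubst B \<sigma>)"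
| "fsubst (Or A B) \<sigma> = Or (fsubst A \<sigma>) (fsubst B \<sigma>)"
| "fsubst (Imp A B) \<sigma> = Imp (fsubst A \<sigma>) (fsubst B \<sigma>)"
| "fsubst (Forall x A) \<sigma> =
     (let z = avoid x (\<Union>v\<in>fv A - {x}. tvars (\<sigma> v)) in Forall z (fsubst A (\<sigma>(x := Var z))))"
| "fsubst (Exists x A) \<sigma> =
     (let z = avoid x (\<Union>v\<in>fv A - {x}. tvars (\<sigma> v)) in Exists z (fsubst A (\<sigma>(x := Var z))))"

definition subst1 :: "var \<Rightarrow> 'f trm \<Rightarrow> ('p, 'f) fm \<Rightarrow> ('p, 'f) fm" where
  "subst1 x s A = fsubst A (Var(x := s))"

definition subst2 :: "var \<Rightarrow> 'f trm \<Rightarrow> var \<Rightarrow> 'f trm \<Rightarrow> ('p, 'f) fm \<Rightarrow> ('p, 'f) fm" where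
  "subst2 x s y t A = fsubst A (Var(x := s, y := t))"

definition inst :: "('p, 'f) fm \<Rightarrow> var list \<Rightarrow> 'f trm list \<Rightarrow> ('p, 'f) fm" where
  "inst A xs us = fsubst A (\<lambda>v. case map_of (zip xs us) v of Some u \<Rightarrow> u | None \<Rightarrow> Var v)"

fun Conj :: "('p, 'f) fm list \<Rightarrow> ('p, 'f) fm" where
  "Conj [] = Neg Bot"
| "Conj [A] = A"
| "Conj (A # B # As) = And A (Conj (B # As))"

fun Disj :: "('p, 'f) fm list \<Rightarrow> ('p, 'f) fm" where
  "Disj [] = Bot"
| "Disj [A] = A"
| "Disj (A # B # As) = Or A (Disj (B # As))"

text \<open>A finite set is enumerated in some arbitrary but fixed order to be written as a formula.\<close>

definition enum_of :: "'a set \<Rightarrow> 'a list" where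
  "enum_of M = (SOME xs. distinct xs \<and> set xs = M)"

definition DNF :: "('p, 'f) fm set set \<Rightarrow> ('p, 'f) fm" where
  "DNF \<C> = Disj (map (\<lambda>C. Conj (enum_of C)) (enum_of \<C>))"

section \<open>Sequents and G3c\<close>

type_synonym ('p, 'f) sequent = "('p, 'f) fm set \<times> ('p, 'f) fm set"

definition seq_fv :: "('p, 'f) sequent \<Rightarrow> var set" where
  "seq_fv S = (\<Union>A\<in>fst S \<union> snd S. fv A)"

text \<open>Truth under an assignment of truth values to the propositionally prime formulas, that is,
  to atoms and to quantified formulas.\<close>

primrec holds :: "(('p, 'f) fm \<Rightarrow> bool) \<Rightarrow> ('p, 'f) fm \<Rightarrow> bool" where
  "holds v (Atom P ts) = v (Atom P ts)"
| "holds v Bot = False"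
| "holds v (Neg A) = (\<not> holds v A)"
| "holds v (And A B) = (holds v A \<and> holds v B)"
| "holds v (Or A B) = (holds v A \<or> holds v B)"
| "holds v (Imp A B) = (holds v A \<longrightarrow> holds v B)"
| "holds v (Forall x A) = v (Forall x A)"
| "holds v (Exists x A) = v (Exists x A)"

definition tautology :: "('p, 'f) sequent \<Rightarrow> bool" where
  "tautology S \<longleftrightarrow> (\<forall>v. (\<forall>A\<in>fst S. holds v A) \<longrightarrow> (\<exists>B\<in>snd S. holds v B))"

text \<open>Initial sequents are not counted as rules here: they are the admissible leaves of a proof.
  As sequents consist of sets, the side formulas may contain the principal formula.\<close>

inductive G3c_rule :: "('p, 'f) sequent list \<Rightarrow> ('p, 'f) sequent \<Rightarrow> bool" where
  NegL: "G3c_rule [(\<Gamma>, insert A \<Delta>)] (insert (Neg A) \<Gamma>, \<Delta>)"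
| NegR: "G3c_rule [(insert A \<Gamma>, \<Delta>)] (\<Gamma>, insert (Neg A) \<Delta>)"
| AndL: "G3c_rule [(insert A (insert B \<Gamma>), \<Delta>)] (insert (And A B) \<Gamma>, \<Delta>)"
| AndR: "G3c_rule [(\<Gamma>, insert A \<Delta>), (\<Gamma>, insert B \<Delta>)] (\<Gamma>, insert (And A B) \<Delta>)"
| OrL: "G3c_rule [(insert A \<Gamma>, \<Delta>), (insert B \<Gamma>, \<Delta>)] (insert (Or A B) \<Gamma>, \<Delta>)"
| OrR: "G3c_rule [(\<Gamma>, insert A (insert B \<Delta>))] (\<Gamma>, insert (Or A B) \<Delta>)"
| ImpL: "G3c_rule [(\<Gamma>, insert A \<Delta>), (insert B \<Gamma>, \<Delta>)] (insert (Imp A B) \<Gamma>, \<Delta>)"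
| ImpR: "G3c_rule [(insert A \<Gamma>, insert B \<Delta>)] (\<Gamma>, insert (Imp A B) \<Delta>)"
| ForallL: "G3c_rule [(insert (subst1 x t A) (insert (Forall x A) \<Gamma>), \<Delta>)] (insert (Forall x A) \<Gamma>, \<Delta>)"
| ForallR: "z \<notin> seq_fv (\<Gamma>, insert (Forall x A) \<Delta>) \<Longrightarrow>
    G3c_rule [(\<Gamma>, insert (subst1 x (Var z) A) \<Delta>)] (\<Gamma>, insert (Forall x A) \<Delta>)"
| ExistsL: "z \<notin> seq_fv (insert (Exists x A) \<Gamma>, \<Delta>) \<Longrightarrow>
    G3c_rule [(insert (subst1 x (Var z) A) \<Gamma>, \<Delta>)] (insert (Exists x A) \<Gamma>, \<Delta>)"
| ExistsR: "G3c_rule [(\<Gamma>, insert (subst1 x t A) (insert (Exists x A) \<Delta>))] (\<Gamma>, insert (Exists x A) \<Delta>)"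

text \<open>On sequents of atoms the second disjunct is void, so being initial then means that some atom
  occurs on both sides.\<close>

definition initial :: "('p, 'f) sequent \<Rightarrow> bool" where
  "initial S \<longleftrightarrow> (\<exists>A\<in>fst S \<inter> snd S. is_atom A) \<or> Bot \<in> fst S"

datatype 's tree = Node (root: 's) (children: "'s tree list")

primrec leaves :: "'s tree \<Rightarrow> 's set" where
  "leaves (Node S \<psi>s) = (if \<psi>s = [] then {S} else \<Union> (set (map leaves \<psi>s)))"

inductive derivation :: "('p, 'f) sequent tree \<Rightarrow> bool" where
  "derivation (Node S [])"
| "G3c_rule (map root \<psi>s) S \<Longrightarrow> \<forall>\<psi>\<in>set \<psi>s. derivation \<psi> \<Longrightarrow> derivation (Node S \<psi>s)"

definition maximal :: "('p, 'f) sequent tree \<Rightarrow> bool" where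
  "maximal \<psi> \<longleftrightarrow> (\<forall>S\<in>leaves \<psi>. \<nexists>Ss. G3c_rule Ss S)"

definition provable :: "('p, 'f) sequent \<Rightarrow> bool" where
  "provable S \<longleftrightarrow> (\<exists>\<psi>. derivation \<psi> \<and> root \<psi> = S \<and> (\<forall>S'\<in>leaves \<psi>. initial S'))"

section \<open>Schematic extended Herbrand sequents\<close>

definition herbrand_term_set ::
  "('p, 'f) fm \<Rightarrow> var list \<Rightarrow> ('p, 'f) fm \<Rightarrow> var list \<Rightarrow> 'f \<Rightarrow> 'f \<Rightarrow> 'f trm set \<Rightarrow> bool" where
  "herbrand_term_set F xs G ys hF hG T \<longleftrightarrow>
     (\<exists>TF TG. finite TF \<and> finite TG \<and>
        (\<forall>t\<in>TF. length t = length xs) \<and> (\<forall>t\<in>TG. length t = length ys) \<and>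
        T = Fun hF ` TF \<union> Fun hG ` TG \<and>
        tautology (inst F xs ` TF, inst G ys ` TG))"

text \<open>Nonterminals are variables. The lists \<open>betas\<close> and \<open>rlist\<close> run in parallel;
  list positions start at 0, so \<open>betas g ! j\<close> is the nonterminal with index \<open>j + 1\<close>.\<close>

record 'f pi2_grammar =
  tau :: var
  alpha :: var
  betas :: "var list"
  ulist :: "'f trm list list"
  vlist :: "'f trm list list"
  rlist :: "'f trm list"
  tlist :: "'f trm list"

definition nonterminals :: "'f pi2_grammar \<Rightarrow> var set" where
  "nonterminals g = {tau g, alpha g} \<union> set (betas g)"

definition schematic_pi2_grammar :: "nat \<Rightarrow> nat \<Rightarrow> 'f pi2_grammar \<Rightarrow> bool" where
  "schematic_pi2_grammar k l g \<longleftrightarrow>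
     distinct (betas g @ [alpha g, tau g]) \<and>
     (\<forall>u\<in>set (ulist g). length u = k \<and> (\<forall>s\<in>set u. tvars s \<subseteq> {alpha g})) \<and>
     (\<forall>v\<in>set (vlist g). length v = l \<and> (\<forall>s\<in>set v. tvars s \<subseteq> set (betas g))) \<and>
     length (rlist g) = length (betas g) \<and>
     (\<forall>j<length (rlist g). tvars (rlist g ! j) \<subseteq> set (take j (betas g))) \<and>
     (\<forall>t\<in>set (tlist g). tvars t \<subseteq> {alpha g})"

definition productions :: "'f \<Rightarrow> 'f \<Rightarrow> 'f pi2_grammar \<Rightarrow> (var \<times> 'f trm) set" where
  "productions hF hG g =
     {(tau g, Fun hF u) |u. u \<in> set (ulist g)} \<union>
     {(tau g, Fun hG v) |v. v \<in> set (vlist g)} \<union>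
     {(alpha g, r) |r. r \<in> set (rlist g)} \<union>
     {(betas g ! j, tsubst t (Var(alpha g := rlist g ! j))) |j t.
        j < length (betas g) \<and> t \<in> set (tlist g)}"

inductive rewrite_step :: "(var \<times> 'f trm) set \<Rightarrow> 'f trm \<Rightarrow> 'f trm \<Rightarrow> bool" for Q where
  "(A, t) \<in> Q \<Longrightarrow> rewrite_step Q (Var A) t"
| "rewrite_step Q s t \<Longrightarrow> rewrite_step Q (Fun f (ss @ s # ss')) (Fun f (ss @ t # ss'))"

text \<open>A derivation is rigid iff the set of productions it uses is single-valued.\<close>

definition language :: "'f \<Rightarrow> 'f \<Rightarrow> 'f pi2_grammar \<Rightarrow> 'f trm set" where
  "language hF hG g =
     {t. tvars t = {} \<and>
         (\<exists>Q\<subseteq>productions hF hG g. single_valued Q \<and> (rewrite_step Q)\<^sup>*\<^sup>* (Var (tau g)) t)}"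

text \<open>The predicate variable is a function argument: the schematic sequent is the map
  sending a binary predicate to a sequent.\<close>

definition schematic_sequent ::
  "('p, 'f) fm \<Rightarrow> var list \<Rightarrow> ('p, 'f) fm \<Rightarrow> var list \<Rightarrow> 'f pi2_grammar \<Rightarrow>
   ('f trm \<Rightarrow> 'f trm \<Rightarrow> ('p, 'f) fm) \<Rightarrow> ('p, 'f) sequent" where
  "schematic_sequent F xs G ys g X =
     (inst F xs ` set (ulist g) \<union>
        {Imp (Disj (map (X (Var (alpha g))) (tlist g)))
             (Conj (map2 (\<lambda>r b. X r (Var b)) (rlist g) (betas g)))},
      inst G ys ` set (vlist g))"

definition reduced_representation ::
  "('p, 'f) fm \<Rightarrow> var list \<Rightarrow> ('p, 'f) fm \<Rightarrow> var list \<Rightarrow> 'f pi2_grammar \<Rightarrow> ('p, 'f) sequent" where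
  "reduced_representation F xs G ys g = (inst F xs ` set (ulist g), inst G ys ` set (vlist g))"

text \<open>The end-sequent may have free variables, which act as constants; the nonterminals
  have to be different from them.\<close>

definition schematic_extended_herbrand_sequent ::
  "('p, 'f) fm \<Rightarrow> var list \<Rightarrow> ('p, 'f) fm \<Rightarrow> var list \<Rightarrow> 'f \<Rightarrow> 'f \<Rightarrow> 'f pi2_grammar \<Rightarrow> bool" where
  "schematic_extended_herbrand_sequent F xs G ys hF hG g \<longleftrightarrow>
     quantifier_free F \<and> quantifier_free G \<and> distinct xs \<and> distinct ys \<and>
     provable ({foldr Forall xs F}, {foldr Exists ys G}) \<and>
     hF \<noteq> hG \<and> {hF, hG} \<inter> (ffuns F \<union> ffuns G) = {} \<and>
     schematic_pi2_grammar (length xs) (length ys) g \<and>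
     nonterminals g \<inter> seq_fv ({foldr Forall xs F}, {foldr Exists ys G}) = {} \<and>
     (\<exists>T. herbrand_term_set F xs G ys hF hG T \<and> T \<subseteq> language hF hG g)"

section \<open>Starting sets and solutions\<close>

text \<open>Falsum may remain on the right of a leaf, where it is void; it contributes no literal.\<close>

definition leaf_literals :: "('p, 'f) sequent \<Rightarrow> ('p, 'f) fm set" where
  "leaf_literals S = {Neg Q |Q. Q \<in> snd S \<and> is_atom Q} \<union> {P \<in> fst S. is_atom P}"

definition DNTA :: "('p, 'f) sequent tree \<Rightarrow> ('p, 'f) fm set set" where
  "DNTA \<psi> = leaf_literals ` {S \<in> leaves \<psi>. \<not> initial S}"

definition A_part :: "'f pi2_grammar \<Rightarrow> ('p, 'f) fm set \<Rightarrow> ('p, 'f) fm set" where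
  "A_part g S = {L \<in> S. alpha g \<in> fv L}"

definition B_part :: "'f pi2_grammar \<Rightarrow> ('p, 'f) fm set \<Rightarrow> ('p, 'f) fm set" where
  "B_part g S = {L \<in> S. fv L \<inter> set (betas g) \<noteq> {}}"

definition N_part :: "'f pi2_grammar \<Rightarrow> ('p, 'f) fm set \<Rightarrow> ('p, 'f) fm set" where
  "N_part g S = {L \<in> S. fv L \<inter> ({alpha g} \<union> set (betas g)) = {}}"

definition starting_set :: "var \<Rightarrow> var \<Rightarrow> ('p, 'f) fm set set \<Rightarrow> bool" where
  "starting_set x y \<A> \<longleftrightarrow>
     finite \<A> \<and> (\<forall>C\<in>\<A>. finite C \<and> (\<forall>L\<in>C. is_literal L \<and> fv L \<subseteq> {x, y}))"

definition T1 :: "'f pi2_grammar \<Rightarrow> var \<Rightarrow> ('p, 'f) fm set list \<Rightarrow> ('p, 'f) fm set \<Rightarrow> bool" where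
  "T1 g x Cs S \<longleftrightarrow>
     (\<exists>i<length (betas g). \<exists>L\<in>Cs ! i. subst1 x (rlist g ! i) L \<in> compl ` N_part g S)"

definition T2 ::
  "'f pi2_grammar \<Rightarrow> var \<Rightarrow> var \<Rightarrow> ('p, 'f) fm set list \<Rightarrow> ('p, 'f) fm set \<Rightarrow> bool" where
  "T2 g x y Cs S \<longleftrightarrow>
     (\<exists>i<length (betas g). \<exists>L\<in>Cs ! i.
        subst2 x (rlist g ! i) y (Var (betas g ! i)) L \<in> compl ` B_part g S)"

definition T3 :: "'f pi2_grammar \<Rightarrow> var \<Rightarrow> var \<Rightarrow> ('p, 'f) fm set list \<Rightarrow> bool" where
  "T3 g x y Cs \<longleftrightarrow>
     (\<exists>i<length (betas g). \<exists>j<length (betas g). \<exists>L\<in>Cs ! i. \<exists>Q\<in>Cs ! j.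
        subst2 x (rlist g ! i) y (Var (betas g ! i)) L =
        subst2 x (rlist g ! j) y (Var (betas g ! j)) (compl Q))"

definition Cl ::
  "'f pi2_grammar \<Rightarrow> var \<Rightarrow> var \<Rightarrow> ('p, 'f) sequent tree \<Rightarrow> ('p, 'f) fm set set \<Rightarrow>
   ('p, 'f) fm set set set" where
  "Cl g x y \<psi> \<A> =
     {\<C>. \<C> \<subseteq> \<A> \<and>
        (\<forall>Cs S. length Cs = length (betas g) \<and> set Cs \<subseteq> \<C> \<and> S \<in> DNTA \<psi> \<longrightarrow>
           T1 g x Cs S \<or> T2 g x y Cs S \<or> T3 g x y Cs)}"

definition A'_part ::
  "'f pi2_grammar \<Rightarrow> var \<Rightarrow> var \<Rightarrow> ('p, 'f) fm set \<Rightarrow> ('p, 'f) fm set" where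
  "A'_part g x y S =
     {L. is_literal L \<and> fv L \<subseteq> {x, y} \<and>
         (\<exists>t\<in>set (tlist g). subst2 x (Var (alpha g)) y t L \<in> A_part g S)}"

definition I_sets ::
  "'f pi2_grammar \<Rightarrow> var \<Rightarrow> var \<Rightarrow> ('p, 'f) fm set \<Rightarrow> ('p, 'f) fm set set" where
  "I_sets g x y S =
     {M. M \<subseteq> A'_part g x y S \<and>
         (\<exists>t\<in>set (tlist g). \<forall>L\<in>M. subst2 x (Var (alpha g)) y t L \<in> A_part g S)}"

text \<open>Below, \<open>\<L> C i\<close> is the literal chosen from the clause \<open>C\<close> for the index \<open>i\<close>.\<close>

definition T1' ::
  "'f pi2_grammar \<Rightarrow> var \<Rightarrow> ('p, 'f) fm set set \<Rightarrow> (('p, 'f) fm set \<Rightarrow> nat \<Rightarrow> ('p, 'f) fm) \<Rightarrow>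
   ('p, 'f) fm set \<Rightarrow> bool" where
  "T1' g y \<C> \<L> S \<longleftrightarrow>
     (\<exists>C\<in>\<C>. \<exists>i<length (tlist g). subst1 y (tlist g ! i) (\<L> C i) \<in> N_part g S)"

definition T2' ::
  "'f pi2_grammar \<Rightarrow> var \<Rightarrow> var \<Rightarrow> ('p, 'f) fm set set \<Rightarrow>
   (('p, 'f) fm set \<Rightarrow> nat \<Rightarrow> ('p, 'f) fm) \<Rightarrow> ('p, 'f) fm set \<Rightarrow> bool" where
  "T2' g x y \<C> \<L> S \<longleftrightarrow>
     (\<exists>C\<in>\<C>. \<exists>M\<in>I_sets g x y S. \<forall>i<length (tlist g). \<L> C i \<in> M)"

definition T3' ::
  "'f pi2_grammar \<Rightarrow> var \<Rightarrow> var \<Rightarrow> ('p, 'f) fm set set \<Rightarrow>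
   (('p, 'f) fm set \<Rightarrow> nat \<Rightarrow> ('p, 'f) fm) \<Rightarrow> bool" where
  "T3' g x y \<C> \<L> \<longleftrightarrow>
     (\<exists>C\<in>\<C>. \<exists>D\<in>\<C>. \<exists>i<length (tlist g). \<exists>j<length (tlist g).
        subst2 x (Var (alpha g)) y (tlist g ! i) (\<L> C i) =
        subst2 x (Var (alpha g)) y (tlist g ! j) (compl (\<L> D j)))"

definition Sol ::
  "'f pi2_grammar \<Rightarrow> var \<Rightarrow> var \<Rightarrow> ('p, 'f) sequent tree \<Rightarrow> ('p, 'f) fm set set \<Rightarrow>
   ('p, 'f) fm set set set" where
  "Sol g x y \<psi> \<A> =
     {\<C> \<in> Cl g x y \<psi> \<A>.
        \<forall>\<L> S. (\<forall>C\<in>\<C>. \<forall>i<length (tlist g). \<L> C i \<in> C) \<and> S \<in> DNTA \<psi> \<longrightarrow>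
          T1' g y \<C> \<L> S \<or> T2' g x y \<C> \<L> S \<or> T3' g x y \<C> \<L>}"

end

theory Submission
  imports Defs
begin

text \<open>A valuation \<open>v\<close> that refutes the sequent refutes some leaf of \<open>\<psi>\<close>, so it satisfies all
  literals of some \<open>S \<in> DNTA \<psi>\<close>. If \<open>v\<close> satisfies all \<open>E r\<^sub>j \<beta>\<^sub>j\<close>, it selects for every \<open>j\<close> a
  clause of \<open>\<C>\<close> all of whose instances are true, contradicting the closure condition; otherwise
  it falsifies all \<open>E \<alpha> t\<^sub>i\<close> and selects for every clause and every \<open>i\<close> a literal with a false
  instance, contradicting the solution condition. The substitutions for \<open>x\<close> alone or \<open>y\<close> alone in
  \<open>T\<^sub>1\<close> and \<open>T\<^sub>1'\<close> agree with the one for both, because \<open>x\<close> and \<open>y\<close> do not occur in the leaves.\<close>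

section \<open>Complements, substitution and free variables\<close>

lemma holds_compl [simp]: "holds v (compl L) \<longleftrightarrow> \<not> holds v L"
  by (cases L) (simp_all add: compl_def)

lemma holds_fsubst_compl [simp]: "holds v (fsubst (compl L) \<sigma>) \<longleftrightarrow> \<not> holds v (fsubst L \<sigma>)"
  by (cases L) (simp_all add: compl_def Let_def)

lemma fv_compl [simp]: "fv (compl L) = fv L"
  by (cases L) (simp_all add: compl_def)

lemma tsubst_cong: "(\<And>v. v \<in> tvars t \<Longrightarrow> \<sigma> v = \<rho> v) \<Longrightarrow> tsubst t \<sigma> = tsubst t \<rho>"
  by (induction t) auto

text \<open>Equality is syntactic even under binders: \<open>avoid\<close> sees a substitution only
  through its values on free variables, so both sides rename bound variables alike.\<close>

lemma fsubst_cong: "(\<And>v. v \<in> fv A \<Longrightarrow> \<sigma> v = \<rho> v) \<Longrightarrow> fsubst A \<sigma> = fsubst A \<rho>"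
proof (induction A arbitrary: \<sigma> \<rho>)
  case (Atom P ts)
  then show ?case by (auto intro!: tsubst_cong)
next
  case (Forall x A)
  have "(\<Union>v\<in>fv A - {x}. tvars (\<sigma> v)) = (\<Union>v\<in>fv A - {x}. tvars (\<rho> v))"
    using Forall.prems by simp
  moreover have "fsubst A (\<sigma>(x := Var z)) = fsubst A (\<rho>(x := Var z))" for z
    using Forall.prems by (intro Forall.IH) simp
  ultimately show ?case by (simp add: Let_def)
next
  case (Exists x A)
  have "(\<Union>v\<in>fv A - {x}. tvars (\<sigma> v)) = (\<Union>v\<in>fv A - {x}. tvars (\<rho> v))"
    using Exists.prems by simp
  moreover have "fsubst A (\<sigma>(x := Var z)) = fsubst A (\<rho>(x := Var z))" for z
    using Exists.prems by (intro Exists.IH) simp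
  ultimately show ?case by (simp add: Let_def)
next
  case (And A B)
  then show ?case by (metis UnCI fsubst.simps(4) fv.simps(4))
next
  case (Or A B)
  then show ?case by (metis UnCI fsubst.simps(5) fv.simps(5))
next
  case (Imp A B)
  then show ?case by (metis UnCI fsubst.simps(6) fv.simps(6))
next
  case (Neg A)
  then show ?case by (metis fsubst.simps(3) fv.simps(3))
qed simp

lemma tvars_tsubst: "tvars (tsubst t \<sigma>) = (\<Union>v\<in>tvars t. tvars (\<sigma> v))"
  by (induction t) auto

lemma fv_fsubst: "quantifier_free A \<Longrightarrow> fv (fsubst A \<sigma>) = (\<Union>v\<in>fv A. tvars (\<sigma> v))"
  by (induction A) (auto simp: tvars_tsubst)

lemma quantifier_free_fsubst [simp]: "quantifier_free A \<Longrightarrow> quantifier_free (fsubst A \<sigma>)"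
  by (induction A) auto

lemma quantifier_free_literal: "is_literal L \<Longrightarrow> quantifier_free L"
proof -
  have "quantifier_free A" if "is_atom A" for A :: "('p, 'f) fm"
    using that by (cases A) auto
  then show "is_literal L \<Longrightarrow> quantifier_free L"
    unfolding is_literal_def by auto
qed

section \<open>Truth of instances of a disjunctive normal form\<close>

lemma holds_fsubst_Conj:
  "holds v (fsubst (Conj As) \<sigma>) \<longleftrightarrow> (\<forall>A\<in>set As. holds v (fsubst A \<sigma>))"
  by (induction As rule: Conj.induct) auto

lemma holds_fsubst_Disj:
  "holds v (fsubst (Disj As) \<sigma>) \<longleftrightarrow> (\<exists>A\<in>set As. holds v (fsubst A \<sigma>))"
  by (induction As rule: Disj.induct) auto

lemma holds_Conj: "holds v (Conj As) \<longleftrightarrow> (\<forall>A\<in>set As. holds v A)"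
  by (induction As rule: Conj.induct) auto

lemma holds_Disj: "holds v (Disj As) \<longleftrightarrow> (\<exists>A\<in>set As. holds v A)"
  by (induction As rule: Disj.induct) auto

lemma set_enum_of: "finite M \<Longrightarrow> set (enum_of M) = M"
  unfolding enum_of_def using finite_distinct_list[of M] by (metis (mono_tags, lifting) someI_ex)

text \<open>Finiteness makes \<open>enum_of\<close> list exactly the given set, so truth does not
  depend on the chosen order.\<close>

lemma holds_subst2_DNF:
  assumes "finite \<C>" "\<And>C. C \<in> \<C> \<Longrightarrow> finite C"
  shows "holds v (subst2 x s y t (DNF \<C>)) \<longleftrightarrow> (\<exists>C\<in>\<C>. \<forall>L\<in>C. holds v (subst2 x s y t L))"
  using assms
  by (simp add: DNF_def subst2_def holds_fsubst_Disj holds_fsubst_Conj set_enum_of)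

text \<open>A free \<open>y\<close> of \<open>L\<close> would survive the substitution for
  \<open>x\<close>; its absence from the result therefore gives its absence from \<open>L\<close>,
  and the value assigned to \<open>y\<close> is immaterial.\<close>

lemma subst1_eq_subst2:
  assumes "x \<noteq> y" "quantifier_free L" "y \<notin> fv (subst1 x s L)"
  shows "subst1 x s L = subst2 x s y t L"
proof -
  have "y \<notin> fv L"
    using assms by (fastforce simp: subst1_def fv_fsubst)
  then show ?thesis
    unfolding subst1_def subst2_def by (intro fsubst_cong) auto
qed

lemma subst2_commute: "x \<noteq> y \<Longrightarrow> subst2 x s y t = subst2 y t x s"
  unfolding subst2_def by (auto simp: fun_upd_twist)

section \<open>Countervaluations along a derivation\<close>

definition refutes :: "(('p, 'f) fm \<Rightarrow> bool) \<Rightarrow> ('p, 'f) sequent \<Rightarrow> bool" where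
  "refutes v S \<longleftrightarrow> (\<forall>A\<in>fst S. holds v A) \<and> (\<forall>B\<in>snd S. \<not> holds v B)"

text \<open>This is invertibility read semantically. Quantifier-freeness excludes the quantifier
  rules, the only ones that can bring new variables into a premise.\<close>

lemma refutes_premise:
  assumes "G3c_rule Ss S" "refutes v S" "\<forall>A\<in>fst S \<union> snd S. quantifier_free A"
  shows "\<exists>S'\<in>set Ss. refutes v S' \<and> (\<forall>A\<in>fst S' \<union> snd S'. quantifier_free A) \<and>
    seq_fv S' \<subseteq> seq_fv S"
  using assms by cases (auto simp: refutes_def seq_fv_def)

text \<open>Follow refuted premises upwards. The bound on variables is carried along to keep
  \<open>x\<close> and \<open>y\<close> out of the leaf.\<close>

lemma refuted_leaf:
  assumes "derivation \<psi>" "refutes v (root \<psi>)" "\<forall>A\<in>fst (root \<psi>) \<union> snd (root \<psi>). quantifier_free A"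
  shows "\<exists>S\<in>leaves \<psi>. refutes v S \<and> (\<forall>A\<in>fst S \<union> snd S. quantifier_free A) \<and>
    seq_fv S \<subseteq> seq_fv (root \<psi>)"
  using assms
proof (induction rule: derivation.induct)
  case (1 S)
  then show ?case by simp
next
  case (2 \<psi>s S)
  obtain \<phi> where \<phi>: "\<phi> \<in> set \<psi>s" "refutes v (root \<phi>)"
      "\<forall>A\<in>fst (root \<phi>) \<union> snd (root \<phi>). quantifier_free A" "seq_fv (root \<phi>) \<subseteq> seq_fv S"
    using refutes_premise[OF 2(1), of v] 2(3,4) by auto
  then obtain S' where S': "S' \<in> leaves \<phi>" "refutes v S'" "\<forall>A\<in>fst S' \<union> snd S'. quantifier_free A"
      "seq_fv S' \<subseteq> seq_fv (root \<phi>)"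
    using 2(2) by blast
  have "S' \<in> leaves (Node S \<psi>s)"
    using \<phi>(1) S'(1) by auto
  moreover have "seq_fv S' \<subseteq> seq_fv (root (Node S \<psi>s))"
    using S'(4) \<phi>(4) by simp
  ultimately show ?case
    using S'(2,3) by blast
qed

lemma refutes_leaf_literals:
  "refutes v S \<Longrightarrow> L \<in> leaf_literals S \<Longrightarrow> holds v L"
  by (auto simp: refutes_def leaf_literals_def)

lemma fv_leaf_literals: "L \<in> leaf_literals S \<Longrightarrow> fv L \<subseteq> seq_fv S"
  by (auto simp: leaf_literals_def seq_fv_def)

lemma refutes_not_initial: "refutes v S \<Longrightarrow> \<not> initial S"
  by (auto simp: refutes_def initial_def)

section \<open>Free variables of the reduced representation\<close>

lemma fv_foldr_Forall: "fv (foldr Forall xs A) = fv A - set xs"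
  by (induction xs) auto

lemma fv_foldr_Exists: "fv (foldr Exists xs A) = fv A - set xs"
  by (induction xs) auto

text \<open>Equal lengths give every variable of \<open>xs\<close> a term, so the default
  \<open>Var\<close> is used only outside \<open>xs\<close>.\<close>

lemma fv_inst:
  assumes "quantifier_free A" "length us = length xs"
  shows "fv (inst A xs us) \<subseteq> (fv A - set xs) \<union> (\<Union>u\<in>set us. tvars u)"
proof
  fix z assume "z \<in> fv (inst A xs us)"
  then obtain w where w: "w \<in> fv A"
      "z \<in> tvars (case map_of (zip xs us) w of Some u \<Rightarrow> u | None \<Rightarrow> Var w)"
    using assms(1) by (auto simp: inst_def fv_fsubst)
  show "z \<in> (fv A - set xs) \<union> (\<Union>u\<in>set us. tvars u)"
  proof (cases "map_of (zip xs us) w")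
    case None
    then have "w \<notin> set xs"
      using assms(2) by (simp add: map_of_zip_is_None)
    with w None show ?thesis by simp
  next
    case (Some u)
    then have "u \<in> set us"
      by (meson map_of_SomeD set_zip_rightD)
    with w Some show ?thesis by auto
  qed
qed

lemma fv_reduced_representation:
  assumes "schematic_extended_herbrand_sequent F xs G ys hF hG g"
  shows "seq_fv (reduced_representation F xs G ys g)
    \<subseteq> seq_fv ({foldr Forall xs F}, {foldr Exists ys G}) \<union> nonterminals g"
proof -
  have F: "quantifier_free F" and G: "quantifier_free G"
    and g: "schematic_pi2_grammar (length xs) (length ys) g"
    using assms by (auto simp: schematic_extended_herbrand_sequent_def)
  have "fv (inst F xs u) \<subseteq> (fv F - set xs) \<union> nonterminals g" if "u \<in> set (ulist g)" for u
    using fv_inst[OF F, of u xs] that g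
    by (fastforce simp: schematic_pi2_grammar_def nonterminals_def)
  moreover have "fv (inst G ys u) \<subseteq> (fv G - set ys) \<union> nonterminals g" if "u \<in> set (vlist g)" for u
    using fv_inst[OF G, of u ys] that g
    by (fastforce simp: schematic_pi2_grammar_def nonterminals_def)
  ultimately show ?thesis
    by (fastforce simp: reduced_representation_def seq_fv_def fv_foldr_Forall fv_foldr_Exists)
qed

section \<open>Semantic content of the closure and solution conditions\<close>

text \<open>Otherwise each index has a clause with all instances true. Then \<open>T1\<close> and
  \<open>T2\<close> make a true instance the complement of a true literal of \<open>S\<close>, and
  \<open>T3\<close> makes two true instances complementary.\<close>

lemma Cl_refuted:
  assumes "\<C> \<in> Cl g x y \<psi> \<A>" and "starting_set x y \<A>" and "x \<noteq> y"
    and "length (rlist g) = length (betas g)"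
    and S: "S \<in> DNTA \<psi>" "\<And>L. L \<in> S \<Longrightarrow> holds v L" "\<And>L. L \<in> S \<Longrightarrow> y \<notin> fv L"
  shows "\<exists>j<length (betas g). \<not> holds v (subst2 x (rlist g ! j) y (Var (betas g ! j)) (DNF \<C>))"
proof (rule ccontr)
  let ?m = "length (betas g)" and ?s = "\<lambda>i. subst2 x (rlist g ! i) y (Var (betas g ! i))"
  assume "\<not> ?thesis"
  moreover have \<C>: "\<C> \<subseteq> \<A>" "finite \<C>" "\<And>C. C \<in> \<C> \<Longrightarrow> finite C"
    using assms(1,2) finite_subset by (auto simp: Cl_def starting_set_def)
  ultimately have "\<forall>i<?m. \<exists>C\<in>\<C>. \<forall>L\<in>C. holds v (?s i L)"
    by (simp add: holds_subst2_DNF)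
  then obtain c where c: "\<And>i. i < ?m \<Longrightarrow> c i \<in> \<C>"
      "\<And>i L. i < ?m \<Longrightarrow> L \<in> c i \<Longrightarrow> holds v (?s i L)"
    by metis
  define Cs where "Cs = map c [0..<?m]"
  have Cs: "length Cs = ?m" "set Cs \<subseteq> \<C>" "\<And>i. i < ?m \<Longrightarrow> Cs ! i = c i"
    using c(1) by (auto simp: Cs_def)
  have "T1 g x Cs S \<or> T2 g x y Cs S \<or> T3 g x y Cs"
    using assms(1) Cs S(1) by (auto simp: Cl_def)
  then show False
  proof (elim disjE)
    assume "T1 g x Cs S"
    then obtain i L K where i: "i < ?m" "L \<in> c i" "K \<in> S" "subst1 x (rlist g ! i) L = compl K"
      using Cs(3) by (auto simp: T1_def N_part_def)
    have "quantifier_free L"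
      using i c(1) \<C>(1) assms(2) quantifier_free_literal by (fastforce simp: starting_set_def)
    \<comment> \<open>The instance is the complement of \<open>K\<close>, so it has the free
      variables of a literal of \<open>S\<close>.\<close>
    moreover have "y \<notin> fv (subst1 x (rlist g ! i) L)"
      using i(3,4) S(3) by simp
    ultimately have "?s i L = compl K"
      using subst1_eq_subst2 assms(3) i(4) by metis
    with c(2)[OF i(1,2)] S(2)[OF i(3)] show False by simp
  next
    assume "T2 g x y Cs S"
    then obtain i L K where "i < ?m" "L \<in> c i" "K \<in> S" "?s i L = compl K"
      using Cs(3) by (auto simp: T2_def B_part_def)
    with c(2)[of i L] S(2)[of K] show False by simp
  next
    assume "T3 g x y Cs"
    then obtain i j L Q where "i < ?m" "j < ?m" "L \<in> c i" "Q \<in> c j" "?s i L = ?s j (compl Q)"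
      using Cs(3) by (auto simp: T3_def)
    with c(2)[of i L] c(2)[of j Q] show False by (simp add: subst2_def)
  qed
qed

text \<open>Dual to the closure argument: all chosen instances are false, so none can lie in
  \<open>S\<close> and no two can be complementary.\<close>

lemma Sol_refuted:
  assumes "\<C> \<in> Sol g x y \<psi> \<A>" and "starting_set x y \<A>" and "x \<noteq> y"
    and S: "S \<in> DNTA \<psi>" "\<And>L. L \<in> S \<Longrightarrow> holds v L" "\<And>L. L \<in> S \<Longrightarrow> x \<notin> fv L"
  shows "\<exists>t\<in>set (tlist g). holds v (subst2 x (Var (alpha g)) y t (DNF \<C>))"
proof (rule ccontr)
  let ?p = "length (tlist g)" and ?s = "\<lambda>i. subst2 x (Var (alpha g)) y (tlist g ! i)"
  assume "\<not> ?thesis"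
  moreover have \<C>: "\<C> \<subseteq> \<A>" "finite \<C>" "\<And>C. C \<in> \<C> \<Longrightarrow> finite C"
    using assms(1,2) finite_subset by (auto simp: Sol_def Cl_def starting_set_def)
  ultimately have "\<forall>C\<in>\<C>. \<forall>i<?p. \<exists>L\<in>C. \<not> holds v (?s i L)"
    by (auto simp: holds_subst2_DNF)
  then obtain \<L> where \<L>: "\<And>C i. C \<in> \<C> \<Longrightarrow> i < ?p \<Longrightarrow> \<L> C i \<in> C"
      "\<And>C i. C \<in> \<C> \<Longrightarrow> i < ?p \<Longrightarrow> \<not> holds v (?s i (\<L> C i))"
    by metis
  then have "T1' g y \<C> \<L> S \<or> T2' g x y \<C> \<L> S \<or> T3' g x y \<C> \<L>"
    using assms(1) S(1) by (auto simp: Sol_def)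
  then show False
  proof (elim disjE)
    assume "T1' g y \<C> \<L> S"
    then obtain C i where i: "C \<in> \<C>" "i < ?p" "subst1 y (tlist g ! i) (\<L> C i) \<in> S"
      by (auto simp: T1'_def N_part_def)
    have "quantifier_free (\<L> C i)"
      using i \<L>(1)[OF i(1,2)] \<C>(1) assms(2) quantifier_free_literal
      by (fastforce simp: starting_set_def)
    \<comment> \<open>The roles of \<open>x\<close> and \<open>y\<close> are exchanged: here
      \<open>y\<close> is replaced and \<open>x\<close> is absent from \<open>S\<close>.\<close>
    then have "subst1 y (tlist g ! i) (\<L> C i) = ?s i (\<L> C i)"
      using subst1_eq_subst2[of y x] S(3)[OF i(3)] assms(3) subst2_commute by metis
    with \<L>(2)[OF i(1,2)] S(2)[OF i(3)] show False by simp
  next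
    assume "T2' g x y \<C> \<L> S"
    \<comment> \<open>One term of \<open>tlist g\<close> sends the whole member of
      \<open>I_sets\<close> into \<open>A_part g S\<close>; \<open>i\<close> is the position of that
      term, and the literal chosen for this very \<open>i\<close> lies in the member.\<close>
    then obtain C i where "C \<in> \<C>" "i < ?p" "?s i (\<L> C i) \<in> S"
      by (fastforce simp: T2'_def I_sets_def A_part_def in_set_conv_nth)
    with \<L>(2) S(2) show False by blast
  next
    assume "T3' g x y \<C> \<L>"
    then obtain C D i j where "C \<in> \<C>" "D \<in> \<C>" "i < ?p" "j < ?p"
        "?s i (\<L> C i) = ?s j (compl (\<L> D j))"
      by (auto simp: T3'_def)
    with \<L>(2)[of C i] \<L>(2)[of D j] show False by (simp add: subst2_def)
  qed
qed

theorem theorem3: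
  fixes F G E :: "('p, 'f) fm"
    and xs ys :: "var list"
    and hF hG :: 'f
    and g :: "'f pi2_grammar"
    and x y :: var
    and \<psi> :: "('p, 'f) sequent tree"
    and \<A> \<C> :: "('p, 'f) fm set set"
  assumes "schematic_extended_herbrand_sequent F xs G ys hF hG g"
    and "x \<noteq> y"
    and "{x, y} \<inter> (nonterminals g \<union> seq_fv ({foldr Forall xs F}, {foldr Exists ys G})) = {}"
    and "derivation \<psi>"
    and "root \<psi> = reduced_representation F xs G ys g"
    and "maximal \<psi>"
    and "starting_set x y \<A>"
    and "Sol g x y \<psi> \<A> \<noteq> {}"
    and "\<C> \<in> Sol g x y \<psi> \<A>"
    and "E = DNF \<C>"
  shows "tautology (schematic_sequent F xs G ys g (\<lambda>s t. subst2 x s y t E))"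
proof (rule ccontr)
  let ?R = "reduced_representation F xs G ys g"
  assume "\<not> ?thesis"
  \<comment> \<open>The countervaluation also makes the added implication true; \<open>imp\<close>
    is that implication with its connectives evaluated.\<close>
  then obtain v where R: "refutes v ?R"
    and imp: "\<exists>t\<in>set (tlist g). holds v (subst2 x (Var (alpha g)) y t E) \<Longrightarrow>
      \<forall>(r, b)\<in>set (zip (rlist g) (betas g)). holds v (subst2 x r y (Var b) E)"
    by (auto simp: tautology_def schematic_sequent_def reduced_representation_def refutes_def
        holds_Conj holds_Disj split_beta)
  have len: "length (rlist g) = length (betas g)" and "quantifier_free F" "quantifier_free G"
    using assms(1) by (auto simp: schematic_extended_herbrand_sequent_def schematic_pi2_grammar_def)
  then have "\<forall>A\<in>fst ?R \<union> snd ?R. quantifier_free A"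
    by (auto simp: reduced_representation_def inst_def)
  then obtain S where S: "S \<in> leaves \<psi>" "refutes v S" "seq_fv S \<subseteq> seq_fv ?R"
    using refuted_leaf[OF assms(4)] R assms(5) by metis
  define M where "M = leaf_literals S"
  have M: "M \<in> DNTA \<psi>" "\<And>L. L \<in> M \<Longrightarrow> holds v L"
    using S refutes_not_initial refutes_leaf_literals unfolding M_def DNTA_def by blast+
  \<comment> \<open>Variables of the leaf come from the end-sequent or the nonterminals, and
    \<open>x\<close>, \<open>y\<close> are apart from both.\<close>
  have xy: "x \<notin> fv L" "y \<notin> fv L" if "L \<in> M" for L
    using that fv_leaf_literals[of L S] S(3) fv_reduced_representation[OF assms(1)] assms(3)
    by (auto simp: M_def)
  \<comment> \<open>The solution condition supplies the antecedent of \<open>imp\<close>; the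
    closure condition then contradicts its consequent.\<close>
  have "\<forall>(r, b)\<in>set (zip (rlist g) (betas g)). holds v (subst2 x r y (Var b) E)"
    using imp Sol_refuted[OF assms(9,7,2) M xy(1)] assms(10) by blast
  moreover obtain j where "j < length (betas g)"
      "\<not> holds v (subst2 x (rlist g ! j) y (Var (betas g ! j)) E)"
    using Cl_refuted[OF _ assms(7,2) len M xy(2)] assms(9,10) unfolding Sol_def by blast
  ultimately show False
    using len by (fastforce simp: set_zip)
qed

end
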